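(* An orientation of a split graph $S_n=(E_{n-m},K_m)$ is semi-transitive if and only if all of the following hold: (1) $K_m$ is oriented transitively; denote by $p_1\to p_2\to\cdots\to p_m$ the resulting directed Hamiltonian path $\vec{P}$ of $K_m$; (2) each vertex in $E_{n-m}$ is of type A, type B or type C (with respect to $\vec{P}$); (3) for every vertex $x\in E_{n-m}$ of type C, with source-group $\{p_1,\ldots,p_a\}$ and sink-group $\{p_b,\ldots,p_m\}$ (where $1\le a<b\le m$): there is no vertex $y\in E_{n-m}$ of type A or B that is adjacent to both $p_a$ and $p_b$, and there is no vertex $y\in E_{n-m}$ of type C such that the source-group of $y$ contains both $p_a$ and $p_b$ or the sink-group of $y$ contains both $p_a$ and $p_b$.
   Context: All graphs are finite and simple. $S_n=(E_{n-m},K_m)$ denotes a graph on $n$ vertices whose vertex set is partitioned into a clique $K_m$ on $m$ vertices and an independent set $E_{n-m}$ on $n-m$ vertices, where the clique $K_m$ is maximal, i.e. every vertex of $E_{n-m}$ has degree at most $m-1$. An orientation is transitive if the presence of edges $u\to v$ and $v\to z$ implies the presence of the edge $u\to z$. A shortcut is an acyclic, non-transitively oriented graph obtained from a directed cycle on at least four vertices by reversing the orientation of one edge and possibly adding more directed edges between its vertices; equivalently, an acyclic, non-transitive oriented graph on vertices $v_0,\ldots,v_k$, $k\ge 3$, containing the directed path $v_0\to v_1\to\cdots\to v_k$ and the edge $v_0\to v_k$. An orientation of a graph is semi-transitive if it is acyclic (no directed cycles) and no induced subgraph is a shortcut. Types. Suppose $K_m$ is transitively oriented, with directed Hamiltonian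 path $\vec{P}=p_1\to p_2\to\cdots\to p_m$ (so $p_i\to p_j$ exactly when $i<j$; $p_1$ is the source and $p_m$ the sink of $K_m$). A vertex $x\in E_{n-m}$ is - of type A if its neighbourhood is a (possibly empty) set of consecutive vertices of $\vec{P}$ and all edges at $x$ are directed away from $x$; - of type B if its neighbourhood is a (possibly empty) set of consecutive vertices of $\vec{P}$ and all edges at $x$ are directed towards $x$; - of type C if there are $1\le a<b\le m$ such that the neighbourhood of $x$ is $\{p_1,\ldots,p_a\}\cup\{p_b,\ldots,p_m\}$, with $p_i\to x$ for all $i\le a$ and $x\to p_i$ for all $i\ge b$. Then $\{p_1,\ldots,p_a\}$ is the source-group and $\{p_b,\ldots,p_m\}$ the sink-group of $x$. *)

theory Defs
  imports "Graph_Theory.Graph_Theory" "HOL-Library.Sublist"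
begin

text \<open>
  A finite simple graph is a \<open>pair_graph\<close>: a finite, loop-free, symmetric arc relation, where each
  undirected edge is represented by its two opposite arcs. An orientation keeps exactly one of them.
\<close>

definition orientation_of :: "'a pair_pre_digraph \<Rightarrow> 'a pair_pre_digraph \<Rightarrow> bool" where
  "orientation_of D G \<longleftrightarrow>
     pverts D = pverts G \<and>
     parcs D \<union> (parcs D)\<inverse> = parcs G \<and>
     parcs D \<inter> (parcs D)\<inverse> = {}"

definition nbhd :: "'a pair_pre_digraph \<Rightarrow> 'a \<Rightarrow> 'a set" where
  "nbhd G x = {v. x \<rightarrow>\<^bsub>G\<^esub> v}"

definition split_graph :: "'a pair_pre_digraph \<Rightarrow> 'a set \<Rightarrow> 'a set \<Rightarrow> bool" where
  "split_graph G E K \<longleftrightarrow>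
     pair_graph G \<and>
     pverts G = E \<union> K \<and> E \<inter> K = {} \<and>
     (\<forall>u\<in>E. \<forall>v\<in>E. \<not> u \<rightarrow>\<^bsub>G\<^esub> v) \<and>
     (\<forall>u\<in>K. \<forall>v\<in>K. u \<noteq> v \<longrightarrow> u \<rightarrow>\<^bsub>G\<^esub> v) \<and>
     (\<forall>x\<in>E. card (nbhd G x) < card K)"

definition acyclic_digraph :: "('a, 'b) pre_digraph \<Rightarrow> bool" where
  "acyclic_digraph H \<longleftrightarrow> acyclic (arcs_ends H)"

definition transitive_digraph :: "('a, 'b) pre_digraph \<Rightarrow> bool" where
  "transitive_digraph H \<longleftrightarrow> trans (arcs_ends H)"

text \<open>The library's \<open>vpath\<close> is not used here because it excludes the empty list.\<close>

definition hamiltonian_dipath :: "('a, 'b) pre_digraph \<Rightarrow> 'a list \<Rightarrow> bool" where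
  "hamiltonian_dipath H p \<longleftrightarrow>
     distinct p \<and> set p = verts H \<and> successively (\<lambda>u v. u \<rightarrow>\<^bsub>H\<^esub> v) p"

definition shortcut :: "('a, 'b) pre_digraph \<Rightarrow> bool" where
  "shortcut H \<longleftrightarrow>
     acyclic_digraph H \<and> \<not> transitive_digraph H \<and>
     (\<exists>p. hamiltonian_dipath H p \<and> 4 \<le> length p \<and> hd p \<rightarrow>\<^bsub>H\<^esub> last p)"

definition semi_transitive :: "('a, 'b) pre_digraph \<Rightarrow> bool" where
  "semi_transitive D \<longleftrightarrow>
     acyclic_digraph D \<and> (\<forall>X \<subseteq> verts D. \<not> shortcut (D \<restriction> X))"

text \<open>
  Below, \<open>G\<close> is the undirected graph, \<open>D\<close> its orientation, and \<open>p\<close> the list of vertices on the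
  directed Hamiltonian path of the clique. Indices are 1-based: \<open>p\<^sub>i\<close> is \<open>p ! (i - 1)\<close>.
  \<open>sublist\<close> is the contiguous-sublist relation.
\<close>

definition type_A :: "'a pair_pre_digraph \<Rightarrow> 'a pair_pre_digraph \<Rightarrow> 'a list \<Rightarrow> 'a \<Rightarrow> bool" where
  "type_A G D p x \<longleftrightarrow>
     (\<exists>q. sublist q p \<and> nbhd G x = set q) \<and> (\<forall>v \<in> nbhd G x. x \<rightarrow>\<^bsub>D\<^esub> v)"

definition type_B :: "'a pair_pre_digraph \<Rightarrow> 'a pair_pre_digraph \<Rightarrow> 'a list \<Rightarrow> 'a \<Rightarrow> bool" where
  "type_B G D p x \<longleftrightarrow>
     (\<exists>q. sublist q p \<and> nbhd G x = set q) \<and> (\<forall>v \<in> nbhd G x. v \<rightarrow>\<^bsub>D\<^esub> x)"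

definition path_vertex :: "'a list \<Rightarrow> nat \<Rightarrow> 'a" where
  "path_vertex p i = p ! (i - 1)"

definition source_group :: "'a list \<Rightarrow> nat \<Rightarrow> 'a set" where
  "source_group p a = path_vertex p ` {1..a}"

definition sink_group :: "'a list \<Rightarrow> nat \<Rightarrow> 'a set" where
  "sink_group p b = path_vertex p ` {b..length p}"

definition type_C ::
  "'a pair_pre_digraph \<Rightarrow> 'a pair_pre_digraph \<Rightarrow> 'a list \<Rightarrow> 'a \<Rightarrow> nat \<Rightarrow> nat \<Rightarrow> bool" where
  "type_C G D p x a b \<longleftrightarrow>
     1 \<le> a \<and> a < b \<and> b \<le> length p \<and>
     nbhd G x = source_group p a \<union> sink_group p b \<and>
     (\<forall>v \<in> source_group p a. v \<rightarrow>\<^bsub>D\<^esub> x) \<and>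
     (\<forall>v \<in> sink_group p b. x \<rightarrow>\<^bsub>D\<^esub> v)"

end

theory Submission
  imports Defs
begin

text \<open>
  In an oriented split graph every shortcut is witnessed by one on four vertices: the orientation is
  semi-transitive iff it is acyclic and every directed path \<open>a \<rightarrow> b \<rightarrow> c \<rightarrow> d\<close> with \<open>a \<rightarrow> d\<close> also has
  the arcs \<open>a \<rightarrow> c\<close> and \<open>b \<rightarrow> d\<close>. Indeed, if \<open>v\<^sub>0 \<rightarrow> v\<^sub>1 \<rightarrow> \<dots> \<rightarrow> v\<^sub>k\<close> and \<open>v\<^sub>0 \<rightarrow> v\<^sub>k\<close>, the condition
  on four vertices gives \<open>v\<^sub>1 \<rightarrow> v\<^sub>k\<close>, since of two consecutive vertices one lies in the clique and the
  clique is transitively oriented; by induction and reversal all \<open>v\<^sub>i \<rightarrow> v\<^sub>j\<close> with \<open>i < j\<close> are arcs.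
  The conditions on types express exactly this: if only \<open>a\<close> or only \<open>d\<close> is independent, neighbourhoods
  are convex along the Hamiltonian path; if only \<open>b\<close> or only \<open>c\<close> is, source-groups are initial and
  sink-groups final segments; if \<open>a, c\<close> or \<open>b, d\<close> are, condition (3) forbids the configuration.
\<close>

section \<open>The condition on four vertices and its necessity\<close>

definition four_path_closed :: "'a rel \<Rightarrow> bool" where
  "four_path_closed r \<longleftrightarrow>
     (\<forall>a b c d. (a, b) \<in> r \<and> (b, c) \<in> r \<and> (c, d) \<in> r \<and> (a, d) \<in> r
        \<longrightarrow> (a, c) \<in> r \<and> (b, d) \<in> r)"

lemma four_path_closedD:
  assumes "four_path_closed r" "(a, b) \<in> r" "(b, c) \<in> r" "(c, d) \<in> r" "(a, d) \<in> r"
  shows "(a, c) \<in> r" "(b, d) \<in> r"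
  using assms(1)[unfolded four_path_closed_def, rule_format, of a b c d] assms(2-) by simp_all

lemma four_path_closed_converse: "four_path_closed (r\<inverse>) \<longleftrightarrow> four_path_closed r"
  unfolding four_path_closed_def by blast

lemma arcs_ends_with_proj [simp]: "arcs_ends (with_proj D) = parcs D"
  by (auto simp: arcs_ends_def arc_to_ends_def)

lemma arcs_ends_induce_with_proj [simp]:
  "arcs_ends (with_proj D \<restriction> X) = parcs D \<inter> X \<times> X"
  by (auto simp: arcs_ends_def arc_to_ends_def)

lemma acyclic_asym:
  assumes "acyclic r" "(u, v) \<in> r"
  shows "(v, u) \<notin> r"
proof
  assume "(v, u) \<in> r"
  then have "(u, u) \<in> r\<^sup>+"
    using assms(2) by (meson r_r_into_trancl)
  then show False
    using assms(1) by (simp add: acyclic_def)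
qed

text \<open>Four vertices with the path \<open>a\<close>, \<open>b\<close>, \<open>c\<close>,
  \<open>d\<close> and the closing arc induce an acyclic graph. It fails to be a shortcut only by
  being transitive, which yields both missing arcs.\<close>

lemma semi_transitive_imp_four_path_closed:
  fixes D :: "'a pair_pre_digraph"
  assumes st: "semi_transitive (with_proj D)" and sub: "Field (parcs D) \<subseteq> pverts D"
  shows "four_path_closed (parcs D)"
  unfolding four_path_closed_def
proof (intro allI impI)
  fix a b c d
  assume *: "(a, b) \<in> parcs D \<and> (b, c) \<in> parcs D \<and> (c, d) \<in> parcs D \<and> (a, d) \<in> parcs D"
  let ?X = "{a, b, c, d}" and ?H = "with_proj D \<restriction> {a, b, c, d}"
  have ac: "acyclic (parcs D)"
    using st by (simp add: semi_transitive_def acyclic_digraph_def)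
  have neq: "distinct [a, b, c, d]"
  proof -
    have neq: "u \<noteq> v" if "(u, v) \<in> parcs D" for u v
      using acyclic_asym[OF ac that] that by blast
    have "a \<noteq> c" "b \<noteq> d"
      using * acyclic_asym[OF ac, of a b] acyclic_asym[OF ac, of b c] by blast+
    then show ?thesis
      using * neq[of a b] neq[of b c] neq[of c d] neq[of a d] by simp
  qed
  have X: "?X \<subseteq> pverts D"
    using * sub by (auto simp: Field_def)
  have "acyclic_digraph ?H"
    using acyclic_subset[OF ac] by (simp add: acyclic_digraph_def)
  moreover have "hamiltonian_dipath ?H [a, b, c, d]"
    using * neq by (simp add: hamiltonian_dipath_def)
  moreover have "\<not> shortcut ?H"
    using st X by (simp add: semi_transitive_def)
  moreover have "hd [a, b, c, d] \<rightarrow>\<^bsub>?H\<^esub> last [a, b, c, d]" "4 \<le> length [a, b, c, d]"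
    using * by simp_all
  ultimately have "transitive_digraph ?H"
    unfolding shortcut_def by blast
  then have tr: "trans (parcs D \<inter> ?X \<times> ?X)"
    by (simp add: transitive_digraph_def)
  show "(a, c) \<in> parcs D \<and> (b, d) \<in> parcs D"
    using * transD[OF tr, of a b c] transD[OF tr, of b c d] by simp
qed

subsection \<open>Segments of sorted lists\<close>

text \<open>The list is cut at the first member \<open>u\<close> of \<open>S\<close> and at the
  first later non-member \<open>y\<close>. A member of \<open>S\<close> after \<open>y\<close> would
  place \<open>y\<close> between it and \<open>u\<close>, against convexity.\<close>

lemma sublist_of_convex:
  assumes sorted: "sorted_wrt (\<lambda>u v. (u, v) \<in> r) p" and "S \<subseteq> set p"
    and convex: "\<And>u v w. \<lbrakk>u \<in> S; w \<in> S; v \<in> set p; (u, v) \<in> r; (v, w) \<in> r\<rbrakk> \<Longrightarrow> v \<in> S"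
  shows "\<exists>q. sublist q p \<and> S = set q"
proof -
  define xs where "xs = takeWhile (\<lambda>v. v \<notin> S) p"
  define q where "q = takeWhile (\<lambda>v. v \<in> S) (dropWhile (\<lambda>v. v \<notin> S) p)"
  define ys where "ys = dropWhile (\<lambda>v. v \<in> S) (dropWhile (\<lambda>v. v \<notin> S) p)"
  have p: "p = xs @ q @ ys"
    by (simp add: xs_def q_def ys_def)
  have xs: "set xs \<inter> S = {}" and q: "set q \<subseteq> S"
    by (auto simp: xs_def q_def dest: set_takeWhileD)
  have "set ys \<inter> S = {}"
  proof (cases ys)
    case (Cons y zs)
    then have y: "y \<notin> S"
      by (metis (mono_tags) dropWhile_eq_Cons_conv ys_def)
    have "dropWhile (\<lambda>v. v \<notin> S) p \<noteq> []"
      using Cons by (metis dropWhile.simps(1) list.distinct(1) ys_def)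
    moreover from this have "hd (dropWhile (\<lambda>v. v \<notin> S) p) \<in> S"
      using hd_dropWhile by blast
    ultimately obtain u us where u: "q = u # us"
      by (cases "dropWhile (\<lambda>v. v \<notin> S) p") (auto simp: q_def)
    show ?thesis
      using convex[of u _ y] sorted y q unfolding p u Cons by (auto simp: sorted_wrt_append)
  qed simp
  then have "S = set q"
    using assms(2) xs q unfolding p by auto
  then show ?thesis
    using p by (auto simp: sublist_def)
qed

text \<open>Everything after the first non-member of \<open>S\<close> lies above it, so none of it
  can belong to the down-closed \<open>S\<close>. This makes source-groups initial segments; the
  dual lemma makes sink-groups final ones.\<close>

lemma down_closed_eq_takeWhile:
  assumes "sorted_wrt (\<lambda>u v. (u, v) \<in> r) p" "S \<subseteq> set p"
    and "\<And>u v. \<lbrakk>v \<in> S; u \<in> set p; (u, v) \<in> r\<rbrakk> \<Longrightarrow> u \<in> S"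
  shows "S = set (takeWhile (\<lambda>v. v \<in> S) p)"
proof -
  let ?xs = "takeWhile (\<lambda>v. v \<in> S) p" and ?ys = "dropWhile (\<lambda>v. v \<in> S) p"
  have p: "p = ?xs @ ?ys"
    by simp
  have "set ?ys \<inter> S = {}"
  proof (cases ?ys)
    case Nil
    then show ?thesis by (simp only: list.set Int_empty_left)
  next
    case (Cons y zs)
    then have "y \<notin> S"
      by (metis (mono_tags) dropWhile_eq_Cons_conv)
    moreover have "y \<in> set p" "\<forall>z\<in>set zs. (y, z) \<in> r"
      using assms(1) p by (metis Cons in_set_conv_decomp, metis Cons sorted_wrt.simps(2) sorted_wrt_append p)
    ultimately show ?thesis
      using assms(3) unfolding Cons by auto
  qed
  moreover have "set p = set ?xs \<union> set ?ys"
    by (metis p set_append)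
  ultimately show ?thesis
    using assms(2) by (auto dest: set_takeWhileD)
qed

lemma up_closed_eq_dropWhile:
  assumes "sorted_wrt (\<lambda>u v. (u, v) \<in> r) p" "S \<subseteq> set p"
    and "\<And>u v. \<lbrakk>u \<in> S; v \<in> set p; (u, v) \<in> r\<rbrakk> \<Longrightarrow> v \<in> S"
  shows "S = set (dropWhile (\<lambda>v. v \<notin> S) p)"
proof -
  let ?xs = "takeWhile (\<lambda>v. v \<notin> S) p" and ?ys = "dropWhile (\<lambda>v. v \<notin> S) p"
  have p: "p = ?xs @ ?ys"
    by simp
  have "set ?ys \<subseteq> S"
  proof (cases ?ys)
    case Nil
    then show ?thesis by (simp only: list.set empty_subsetI)
  next
    case (Cons y zs)
    then have "y \<in> S"
      by (metis (mono_tags) dropWhile_eq_Cons_conv)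
    moreover have "set zs \<subseteq> set p" "\<forall>z\<in>set zs. (y, z) \<in> r"
      using assms(1) p by (metis Cons set_dropWhileD list.set_intros(2) subsetI, metis Cons sorted_wrt.simps(2) sorted_wrt_append p)
    ultimately show ?thesis
      using assms(3) unfolding Cons by auto
  qed
  moreover have "set p = set ?xs \<union> set ?ys"
    by (metis p set_append)
  ultimately show ?thesis
    using assms(2) by (auto dest: set_takeWhileD)
qed

lemma set_drop_eq_nth: "set (drop n p) = (!) p ` {n..<length p}"
proof -
  have "drop n p = map ((!) p) [n..<length p]"
    by (simp add: list_eq_iff_nth_eq)
  then show ?thesis by simp
qed

lemma source_group_eq_take:
  assumes "a \<le> length p"
  shows "source_group p a = set (take a p)"
proof -
  have "{1..a} = Suc ` {0..<a}"
    by (simp add: atLeastLessThanSuc_atLeastAtMost)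
  then show ?thesis
    using assms by (simp add: source_group_def path_vertex_def image_image nth_image[symmetric] atLeast0LessThan)
qed

text \<open>The 1-based index \<open>b\<close> is list position \<open>b - 1\<close>, and
  \<open>1 \<le> b\<close> makes the subtraction a genuine shift.\<close>

lemma sink_group_eq_drop:
  assumes "1 \<le> b"
  shows "sink_group p b = set (drop (b - 1) p)"
proof -
  have "{b..length p} = Suc ` {b - 1..<length p}"
    using assms by (simp add: atLeastLessThanSuc_atLeastAtMost)
  then show ?thesis
    by (simp add: sink_group_def path_vertex_def image_image set_drop_eq_nth del: image_Suc_atLeastLessThan)
qed

text \<open>A finite acyclic relation is well-founded, so \<open>K\<close> has a vertex without
  incoming arcs from \<open>K\<close>. By totality it precedes all others and heads the
  list.\<close>

lemma finite_total_acyclic_sorted_list: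
  assumes "finite K" "acyclic r" "\<And>u v. \<lbrakk>u \<in> K; v \<in> K; u \<noteq> v\<rbrakk> \<Longrightarrow> (u, v) \<in> r \<or> (v, u) \<in> r"
  shows "\<exists>p. distinct p \<and> set p = K \<and> sorted_wrt (\<lambda>u v. (u, v) \<in> r) p"
  using assms(1,3)
proof (induction K rule: finite_psubset_induct)
  case (psubset K)
  show ?case
  proof (cases "K = {}")
    case False
    have "wf (r \<inter> K \<times> K)"
      using psubset.hyps acyclic_subset[OF assms(2)] by (simp add: finite_acyclic_wf)
    moreover obtain k where "k \<in> K"
      using False by blast
    ultimately obtain m where m: "m \<in> K" and min: "\<forall>u. (u, m) \<in> r \<inter> K \<times> K \<longrightarrow> u \<notin> K"
      by (rule wfE_min) blast
    have "\<exists>p. distinct p \<and> set p = K - {m} \<and> sorted_wrt (\<lambda>u v. (u, v) \<in> r) p"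
      using psubset.prems m by (intro psubset.IH) auto
    then obtain p where p: "distinct p" "set p = K - {m}" "sorted_wrt (\<lambda>u v. (u, v) \<in> r) p"
      by blast
    have "\<forall>v\<in>K - {m}. (m, v) \<in> r"
      using psubset.prems m min by blast
    then show ?thesis
      using p m by (intro exI[of _ "m # p"]) (simp add: insert_absorb)
  qed simp
qed

subsection \<open>Split orientations as relations\<close>

text \<open>The combinatorial core speaks of the arc relation alone. All assumptions are invariant
  under reversal of the arcs, so each statement also has a mirror image.\<close>

locale split_orientation =
  fixes r :: "'a rel" and E K :: "'a set"
  assumes finite_K: "finite K"
    and disjoint: "E \<inter> K = {}"
    and arc_ends: "(u, v) \<in> r \<Longrightarrow> u \<in> E \<union> K \<and> v \<in> E \<union> K"
    and independent: "\<lbrakk>x \<in> E; y \<in> E\<rbrakk> \<Longrightarrow> (x, y) \<notin> r"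
    and clique: "\<lbrakk>u \<in> K; v \<in> K; u \<noteq> v\<rbrakk> \<Longrightarrow> (u, v) \<in> r \<or> (v, u) \<in> r"
    and asym: "(u, v) \<in> r \<Longrightarrow> (v, u) \<notin> r"
begin

lemma split_orientation_converse: "split_orientation (r\<inverse>) E K"
proof
  show "u \<in> E \<union> K \<and> v \<in> E \<union> K" if "(u, v) \<in> r\<inverse>" for u v
    using arc_ends[of v u] that by simp
  show "(x, y) \<notin> r\<inverse>" if "x \<in> E" "y \<in> E" for x y
    using independent[of y x] that by simp
  show "(u, v) \<in> r\<inverse> \<or> (v, u) \<in> r\<inverse>" if "u \<in> K" "v \<in> K" "u \<noteq> v" for u v
    using clique[of u v] that by auto
  show "(v, u) \<notin> r\<inverse>" if "(u, v) \<in> r\<inverse>" for u v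
    using asym[of v u] that by simp
qed (fact finite_K disjoint)+

section \<open>Shortening walks under the condition on four vertices\<close>

lemma nbr_E:
  assumes "x \<in> E"
  shows "(x, v) \<in> r \<Longrightarrow> v \<in> K" "(v, x) \<in> r \<Longrightarrow> v \<in> K"
  using assms arc_ends[of x v] arc_ends[of v x] independent[of x v] independent[of v x] by blast+

text \<open>The walk may leave the clique. If \<open>u = v\<close>, or if the clique arc led from
  \<open>v\<close> to \<open>u\<close>, there would be a directed cycle.\<close>

lemma trancl_clique:
  assumes "acyclic r" "(u, v) \<in> r\<^sup>+" "u \<in> K" "v \<in> K"
  shows "(u, v) \<in> r"
  using assms clique[of u v] unfolding acyclic_def by (metis trancl.trancl_into_trancl)

text \<open>The second vertex of a walk inherits the closing arc. Neighbours of an independent end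
  of the walk lie in the clique, where walks shrink to single arcs; what remains is a path on four
  vertices.\<close>

lemma bypass_first:
  assumes ac: "acyclic r" and closed: "four_path_closed r"
    and ab: "(a, b) \<in> r" and bd: "(b, d) \<in> r\<^sup>+" and ad: "(a, d) \<in> r"
  shows "(b, d) \<in> r"
proof (rule ccontr)
  assume n: "(b, d) \<notin> r"
  note C = four_path_closedD[OF closed] and T = trancl_clique[OF ac]
  \<comment> \<open>\<open>c\<close> follows \<open>b\<close> on the walk and \<open>e\<close>
    precedes \<open>d\<close>; the two may coincide.\<close>
  obtain c where c: "(b, c) \<in> r" "(c, d) \<in> r\<^sup>+"
    using bd n by (metis converse_tranclE)
  obtain e where e: "(c, e) \<in> r\<^sup>*" "(e, d) \<in> r"
    using c(2) by (meson tranclD2)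
  consider "b \<in> K" "d \<in> K" | "b \<in> E" "d \<in> K" | "b \<in> K" "d \<in> E" | "b \<in> E" "d \<in> E"
    using arc_ends ab ad by blast
  then show False
  proof cases
    case 1
    then show False using T bd n by blast
  next
    case 2
    then have "(c, d) \<in> r" using T c nbr_E by blast
    then show False using C(2) ab c(1) ad n by blast
  next
    case 3
    moreover have "(b, e) \<in> r\<^sup>+" using c(1) e(1) by (rule rtrancl_into_trancl2)
    ultimately have "(b, e) \<in> r" using T e nbr_E by blast
    then show False using C(2) ab e(2) ad n by blast
  next
    case 4
    \<comment> \<open>With both \<open>b\<close> and \<open>d\<close> independent the condition is
      used twice: on \<open>a\<close>, \<open>b\<close>, \<open>c\<close>, \<open>e\<close> to
      obtain the arc from \<open>b\<close> to \<open>e\<close>, then on \<open>a\<close>,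
      \<open>b\<close>, \<open>e\<close>, \<open>d\<close>.\<close>
    have K: "a \<in> K" "c \<in> K" "e \<in> K"
      using 4 ab c e nbr_E by blast+
    show False
    proof (cases "c = e")
      case True
      then show False using C(2)[OF ab c(1)] e ad n by blast
    next
      case False
      then have ce: "(c, e) \<in> r" using T K e(1) by (metis rtranclD)
      have "(a, e) \<in> r\<^sup>+" using ab c(1) ce by (meson trancl.intros)
      then have ae: "(a, e) \<in> r" using T K by blast
      have "(b, e) \<in> r" using C(2)[OF ab c(1) ce ae] .
      then show False using C(2)[OF ab _ e(2) ad] n by blast
    qed
  qed
qed

text \<open>Mirror image of \<open>bypass_first\<close>: in the reversed relation \<open>d\<close>,
  \<open>c\<close>, \<open>a\<close> play the roles of \<open>a\<close>, \<open>b\<close>,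
  \<open>d\<close>.\<close>

lemma bypass_last:
  assumes "acyclic r" "four_path_closed r"
    and "(a, c) \<in> r\<^sup>+" "(c, d) \<in> r" "(a, d) \<in> r"
  shows "(a, c) \<in> r"
proof -
  interpret rev: split_orientation "r\<inverse>" E K
    by (rule split_orientation_converse)
  show ?thesis
    using rev.bypass_first[of d c a] assms
    by (simp add: four_path_closed_converse trancl_converse)
qed

text \<open>\<open>bypass_first\<close> passes the closing arc to the tail, which is sorted by
  induction. Each vertex of the tail other than the last then has an arc to the last one, so
  \<open>bypass_last\<close> gives it an arc from the head.\<close>

lemma sorted_of_successively:
  assumes "acyclic r" "four_path_closed r"
    and "successively (\<lambda>u v. (u, v) \<in> r) p" "2 \<le> length p" "(hd p, last p) \<in> r"
  shows "sorted_wrt (\<lambda>u v. (u, v) \<in> r) p"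
  using assms(3-)
proof (induction p)
  case (Cons x p)
  show ?case
  \<comment> \<open>\<open>p\<close> is now the tail, so this is the path on two vertices.\<close>
  proof (cases "length p = 1")
    case True
    then show ?thesis using Cons.prems by (auto simp: length_Suc_conv)
  next
    case False
    then obtain y q where p: "p = y # q" "q \<noteq> []"
      using Cons.prems by (cases p) auto
    let ?l = "last q"
    have xy: "(x, y) \<in> r" and xl: "(x, ?l) \<in> r"
      and succ: "successively (\<lambda>u v. (u, v) \<in> r) (y # q)"
      using Cons.prems p by auto
    have "successively (\<lambda>u v. (u, v) \<in> r\<^sup>+) (x # p)"
      using Cons.prems(1) by (rule successively_mono) auto
    then have reach: "sorted_wrt (\<lambda>u v. (u, v) \<in> r\<^sup>+) (x # p)"
      by (subst (asm) successively_conv_sorted_wrt) (auto intro: transpI)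
    have "(y, ?l) \<in> r"
      using bypass_first[OF assms(1,2) xy _ xl] reach p by simp
    then have sorted: "sorted_wrt (\<lambda>u v. (u, v) \<in> r) p"
      using Cons.IH succ p by (cases q) auto
    have "(x, z) \<in> r" if "z \<in> set p" for z
    proof (cases "z = ?l")
      case False
      obtain p' where p': "p = p' @ [?l]"
        using p by (metis append_butlast_last_id last_ConsR list.distinct(1))
      have "(z, ?l) \<in> r"
        using that sorted False by (subst (asm) (1 2) p') (auto simp: sorted_wrt_append)
      then show ?thesis
        using bypass_last[OF assms(1,2) _ _ xl] reach that by simp
    qed (use xl in simp)
    then show ?thesis using sorted by simp
  qed
qed simp

text \<open>By sortedness any two vertices of the path are joined, and acyclicity fixes the
  direction. This contradicts the non-transitivity of a shortcut.\<close>

lemma trans_of_shortcut_path: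
  assumes ac: "acyclic r" and closed: "four_path_closed r"
    and p: "successively (\<lambda>u v. (u, v) \<in> r) p" "2 \<le> length p" "(hd p, last p) \<in> r"
  shows "trans (r \<inter> set p \<times> set p)"
proof (rule transI)
  fix u v w
  assume *: "(u, v) \<in> r \<inter> set p \<times> set p" "(v, w) \<in> r \<inter> set p \<times> set p"
  have "sorted_wrt (\<lambda>u v. (u, v) \<in> r) p"
    by (rule sorted_of_successively[OF ac closed p])
  moreover have "u \<noteq> w"
    using * asym by blast
  moreover have "(w, u) \<notin> r"
  proof
    assume "(w, u) \<in> r"
    then have "(u, u) \<in> r\<^sup>+"
      using * by (meson IntD1 trancl.intros)
    then show False using ac by (simp add: acyclic_def)
  qed
  ultimately show "(u, w) \<in> r \<inter> set p \<times> set p"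
    using * by (auto simp: sorted_wrt_iff_nth_less in_set_conv_nth) (metis linorder_neqE_nat)
qed

text \<open>These local conditions are what the types provide. Detours through \<open>E\<close> are
  replaced by clique arcs, which excludes cycles; the condition on four vertices is then checked
  according to which of them are independent.\<close>

lemma acyclic_four_path_closedI:
  assumes trans: "\<And>u v w. \<lbrakk>u \<in> K; v \<in> K; w \<in> K; (u, v) \<in> r; (v, w) \<in> r\<rbrakk> \<Longrightarrow> (u, w) \<in> r"
    and through: "\<And>x u w. \<lbrakk>x \<in> E; (u, x) \<in> r; (x, w) \<in> r\<rbrakk> \<Longrightarrow> (u, w) \<in> r"
    and down: "\<And>x u v w. \<lbrakk>x \<in> E; u \<in> K; (u, v) \<in> r; (v, x) \<in> r; (x, w) \<in> r\<rbrakk> \<Longrightarrow> (u, x) \<in> r"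
    and up: "\<And>x u v w. \<lbrakk>x \<in> E; w \<in> K; (u, x) \<in> r; (x, v) \<in> r; (v, w) \<in> r\<rbrakk> \<Longrightarrow> (x, w) \<in> r"
    and out_convex: "\<And>x u v w. \<lbrakk>x \<in> E; v \<in> K; (x, u) \<in> r; (x, w) \<in> r; (u, v) \<in> r; (v, w) \<in> r\<rbrakk>
      \<Longrightarrow> (x, v) \<in> r"
    and in_convex: "\<And>x u v w. \<lbrakk>x \<in> E; v \<in> K; (u, x) \<in> r; (w, x) \<in> r; (u, v) \<in> r; (v, w) \<in> r\<rbrakk>
      \<Longrightarrow> (v, x) \<in> r"
    and separated: "\<And>x y u w. \<lbrakk>x \<in> E; y \<in> E; (u, x) \<in> r; (x, w) \<in> r\<rbrakk>
      \<Longrightarrow> \<not> ((y, u) \<in> r \<and> (y, w) \<in> r) \<and> \<not> ((u, y) \<in> r \<and> (w, y) \<in> r)"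
  shows "acyclic r \<and> four_path_closed r"
proof
  \<comment> \<open>Invariant of walks from a clique vertex: an end in \<open>E\<close> is entered
    from some clique vertex \<open>w\<close>, which is \<open>u\<close> itself or is reached from
    \<open>u\<close> by one arc.\<close>
  have reach: "(v \<in> K \<longrightarrow> (u, v) \<in> r) \<and>
      (v \<in> E \<longrightarrow> (\<exists>w\<in>K. (w, v) \<in> r \<and> (u = w \<or> (u, w) \<in> r)))"
    if "(u, v) \<in> r\<^sup>+" "u \<in> K" for u v
    using that
  proof induction
    case (base v)
    then show ?case using disjoint by blast
  next
    case (step v w)
    consider "v \<in> K" | "v \<in> E" "w \<in> K"
      using step.hyps(2) arc_ends independent by blast
    then show ?case
    proof cases
      case 1
      then show ?thesis using step trans disjoint by blast
    next
      case 2
      then show ?thesis using step trans through disjoint by blast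
    qed
  qed
  show "acyclic r"
    unfolding acyclic_def
  proof (intro allI notI)
    fix x
    assume x: "(x, x) \<in> r\<^sup>+"
    have no_cycle: "(u, u) \<notin> r\<^sup>+" if "u \<in> K" for u
      using reach that asym by blast
    \<comment> \<open>\<open>x\<close> and its successor \<open>y\<close> both lie on the cycle, and
      one of them is in the clique.\<close>
    obtain y where y: "(x, y) \<in> r" "(y, x) \<in> r\<^sup>*"
      using x by (meson tranclD)
    then have "(y, y) \<in> r\<^sup>+"
      by (meson rtrancl_into_trancl1)
    then show False
      using no_cycle x y(1) arc_ends independent by blast
  qed
  show "four_path_closed r"
    unfolding four_path_closed_def
  proof (intro allI impI)
    fix a b c d
    assume *: "(a, b) \<in> r \<and> (b, c) \<in> r \<and> (c, d) \<in> r \<and> (a, d) \<in> r"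
    \<comment> \<open>Cyclically consecutive vertices are adjacent, so at most one of the four is
      independent, or else an opposite pair is.\<close>
    consider "a \<in> K" "b \<in> K" "c \<in> K" "d \<in> K" | "a \<in> E" "b \<in> K" "c \<in> K" "d \<in> K"
      | "a \<in> K" "b \<in> E" "c \<in> K" "d \<in> K" | "a \<in> K" "b \<in> K" "c \<in> E" "d \<in> K"
      | "a \<in> K" "b \<in> K" "c \<in> K" "d \<in> E" | "a \<in> E" "c \<in> E" | "b \<in> E" "d \<in> E"
      using * arc_ends independent by blast
    then show "(a, c) \<in> r \<and> (b, d) \<in> r"
    proof cases
      case 1
      then show ?thesis using * trans by blast
    next
      case 2
      then show ?thesis using * trans[of b c d] out_convex[of a c b d] by blast
    next
      case 3
      then show ?thesis using * through[of b a c] up[of b d a c] by blast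
    next
      case 4
      then show ?thesis using * through[of c b d] down[of c a b d] by blast
    next
      case 5
      then show ?thesis using * trans[of a b c] in_convex[of d b a c] by blast
    next
      case 6
      then show ?thesis using * separated[of c a b d] by blast
    next
      case 7
      then show ?thesis using * separated[of b d a c] by blast
    qed
  qed
qed

end

subsection \<open>Types of independent vertices\<close>

locale oriented_split_graph =
  fixes G D :: "'a pair_pre_digraph" and E K :: "'a set"
  assumes split: "split_graph G E K" and orientation: "orientation_of D G"
begin

abbreviation r :: "'a rel" where
  "r \<equiv> parcs D"

sublocale pair_graph G
  using split by (simp add: split_graph_def)

lemma verts_D: "pverts D = E \<union> K"
  using split orientation by (simp add: split_graph_def orientation_of_def)

lemma arcs_G: "parcs G = r \<union> r\<inverse>"
  using orientation by (simp add: orientation_of_def)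

lemma Field_r: "Field r \<subseteq> pverts D"
proof
  fix v
  assume "v \<in> Field r"
  then obtain u where "(u, v) \<in> parcs G"
    unfolding Field_def arcs_G by blast
  then show "v \<in> pverts D"
    using in_arcsD2 orientation by (auto simp: orientation_of_def)
qed

sublocale split_orientation r E K
proof
  show "finite K"
    by (rule finite_subset[OF _ finite_verts]) (use split in \<open>auto simp: split_graph_def\<close>)
  show "E \<inter> K = {}"
    using split by (simp add: split_graph_def)
  show "u \<in> E \<union> K \<and> v \<in> E \<union> K" if "(u, v) \<in> r" for u v
    using Field_r verts_D FieldI1[OF that] FieldI2[OF that] by blast
  show "(x, y) \<notin> r" if "x \<in> E" "y \<in> E" for x y
    using split that arcs_G by (simp add: split_graph_def)
  show "(u, v) \<in> r \<or> (v, u) \<in> r" if "u \<in> K" "v \<in> K" "u \<noteq> v" for u v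
    using split that arcs_G by (simp add: split_graph_def)
  show "(v, u) \<notin> r" if "(u, v) \<in> r" for u v
    using orientation that unfolding orientation_of_def by blast
qed

lemma mem_nbhd: "v \<in> nbhd G x \<longleftrightarrow> (x, v) \<in> r \<or> (v, x) \<in> r"
  by (simp add: nbhd_def arcs_G)

text \<open>Replaces the quantification over induced subgraphs by a condition on arcs: the path of a
  shortcut would make its vertex set transitive.\<close>

lemma semi_transitive_iff:
  "semi_transitive (with_proj D) \<longleftrightarrow> acyclic r \<and> four_path_closed r"
proof
  assume "semi_transitive (with_proj D)"
  then show "acyclic r \<and> four_path_closed r"
    using semi_transitive_imp_four_path_closed Field_r
    by (auto simp: semi_transitive_def acyclic_digraph_def)
next
  assume *: "acyclic r \<and> four_path_closed r"
  have "\<not> shortcut (with_proj D \<restriction> X)" for X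
  proof
    assume "shortcut (with_proj D \<restriction> X)"
    then obtain p where nt: "\<not> trans (r \<inter> X \<times> X)" and p: "set p = X" "4 \<le> length p"
      "successively (\<lambda>u v. (u, v) \<in> r \<inter> X \<times> X) p" "(hd p, last p) \<in> r"
      unfolding shortcut_def hamiltonian_dipath_def transitive_digraph_def by auto
    have "successively (\<lambda>u v. (u, v) \<in> r) p"
      using p(3) by (rule successively_mono) simp
    then show False
      using trans_of_shortcut_path[of p] * p nt by auto
  qed
  then show "semi_transitive (with_proj D)"
    using * by (simp add: semi_transitive_def acyclic_digraph_def)
qed

lemma hamiltonian_dipath_iff:
  assumes "trans (r \<inter> K \<times> K)"
  shows "hamiltonian_dipath (with_proj D \<restriction> K) p \<longleftrightarrow>
    distinct p \<and> set p = K \<and> sorted_wrt (\<lambda>u v. (u, v) \<in> r) p"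
proof -
  let ?R = "\<lambda>u v. (u, v) \<in> r \<inter> K \<times> K"
  have "successively ?R p \<longleftrightarrow> sorted_wrt ?R p"
    by (rule successively_conv_sorted_wrt) (use assms in \<open>auto intro!: transpI dest: transD\<close>)
  moreover have "sorted_wrt ?R p \<longleftrightarrow> sorted_wrt (\<lambda>u v. (u, v) \<in> r) p" if "set p = K"
    using that by (auto simp: sorted_wrt_iff_nth_less)
  ultimately show ?thesis
    by (auto simp: hamiltonian_dipath_def)
qed

lemma nbhd_sub_K: "x \<in> E \<Longrightarrow> nbhd G x \<subseteq> K"
  by (auto simp: mem_nbhd dest: nbr_E)

section \<open>Types as order properties along a fixed path through the clique\<close>

context
  fixes p
  assumes set_p: "set p = K" and sorted_p: "sorted_wrt (\<lambda>u v. (u, v) \<in> r) p"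
begin

lemma sorted_nth: "\<lbrakk>i < j; j < length p\<rbrakk> \<Longrightarrow> (p ! i, p ! j) \<in> r"
  using sorted_p by (simp add: sorted_wrt_iff_nth_less)

lemma nth_arc_imp_less:
  assumes "(p ! i, p ! j) \<in> r" "i < length p" "j < length p"
  shows "i < j"
  using assms sorted_nth asym by (metis linorder_neqE_nat)

lemma K_index: "v \<in> K \<Longrightarrow> \<exists>i<length p. v = p ! i"
  using set_p by (metis in_set_conv_nth)

text \<open>A vertex before the segment has an arc to \<open>u\<close>, and one after it receives an
  arc from \<open>w\<close>; both contradict asymmetry.\<close>

lemma sublist_convex:
  assumes "sublist q p" "u \<in> set q" "w \<in> set q" "v \<in> K" "(u, v) \<in> r" "(v, w) \<in> r"
  shows "v \<in> set q"
proof -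
  obtain xs ys where p: "p = xs @ q @ ys"
    using assms(1) by (auto simp: sublist_def)
  then have "v \<in> set xs \<union> set q \<union> set ys"
    using assms(4) set_p by auto
  then show ?thesis
    using assms sorted_p asym unfolding p by (auto simp: sorted_wrt_append)
qed

lemma type_CI:
  assumes x: "x \<in> E" and uw: "(u, x) \<in> r" "(x, w) \<in> r"
    and down: "\<And>u v. \<lbrakk>u \<in> K; (u, v) \<in> r; (v, x) \<in> r\<rbrakk> \<Longrightarrow> (u, x) \<in> r"
    and up: "\<And>v w. \<lbrakk>w \<in> K; (x, v) \<in> r; (v, w) \<in> r\<rbrakk> \<Longrightarrow> (x, w) \<in> r"
  shows "\<exists>a b. type_C G D p x a b"
proof -
  define I where "I = {v. (v, x) \<in> r}"
  define J where "J = {v. (x, v) \<in> r}"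
  \<comment> \<open>\<open>a\<close> is the 1-based index of the last in-neighbour, hence a plain
    length; \<open>b\<close> is that of the first out-neighbour, hence the
    \<open>Suc\<close>.\<close>
  define a where "a = length (takeWhile (\<lambda>v. v \<in> I) p)"
  define b where "b = Suc (length (takeWhile (\<lambda>v. v \<notin> J) p))"
  have sub: "I \<subseteq> set p" "J \<subseteq> set p"
    using x nbr_E set_p by (auto simp: I_def J_def)
  have I: "I = set (takeWhile (\<lambda>v. v \<in> I) p)"
    by (rule down_closed_eq_takeWhile[OF sorted_p sub(1)]) (use down set_p in \<open>auto simp: I_def\<close>)
  have J: "J = set (dropWhile (\<lambda>v. v \<notin> J) p)"
    by (rule up_closed_eq_dropWhile[OF sorted_p sub(2)]) (use up set_p in \<open>auto simp: J_def\<close>)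
  have "u \<in> I" "w \<in> J"
    using uw by (auto simp: I_def J_def)
  have a: "1 \<le> a" "a \<le> length p"
    using \<open>u \<in> I\<close> I by (auto simp: a_def length_takeWhile_le Suc_le_eq length_greater_0_conv)
  have "length (takeWhile (\<lambda>v. v \<notin> J) p) \<noteq> length p"
    using \<open>w \<in> J\<close> J by (metis append_Nil2 append_eq_append_conv empty_iff list.set(1) takeWhile_dropWhile_id)
  then have b: "b \<le> length p"
    using length_takeWhile_le[of "\<lambda>v. v \<notin> J" p] by (simp add: b_def)
  have "p ! (b - 1) \<in> J"
    using nth_length_takeWhile[of "\<lambda>v. v \<notin> J" p] b by (simp add: b_def)
  then have "p ! (b - 1) \<notin> I"
    using asym by (auto simp: I_def J_def)
  \<comment> \<open>The first \<open>a\<close> vertices are all in-neighbours, but the one at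
    position \<open>b - 1\<close> is not.\<close>
  then have "a < b"
    using set_takeWhileD[of "p ! (b - 1)" "\<lambda>v. v \<in> I" p] takeWhile_nth[of "b - 1" "\<lambda>v. v \<in> I" p]
    by (metis I a_def b_def diff_Suc_1 less_Suc_eq_le not_less nth_mem)
  moreover have "source_group p a = I"
    using I a by (metis a_def source_group_eq_take takeWhile_eq_take)
  moreover have "sink_group p b = J"
    using J by (metis b_def diff_Suc_1 sink_group_eq_drop dropWhile_eq_drop le_add1 plus_1_eq_Suc)
  ultimately have "type_C G D p x a b"
    using a b by (auto simp: type_C_def I_def J_def mem_nbhd)
  then show ?thesis by blast
qed

text \<open>The two groups exhaust the neighbourhood, and by asymmetry no vertex is both an in- and
  an out-neighbour.\<close>

lemma type_C_groups:
  assumes "type_C G D p x a b"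
  shows "v \<in> source_group p a \<longleftrightarrow> (v, x) \<in> r" "v \<in> sink_group p b \<longleftrightarrow> (x, v) \<in> r"
proof -
  have "v \<in> source_group p a \<union> sink_group p b \<longleftrightarrow> (x, v) \<in> r \<or> (v, x) \<in> r"
    using assms by (simp add: type_C_def mem_nbhd[symmetric])
  moreover have "v \<in> source_group p a \<Longrightarrow> (v, x) \<in> r" "v \<in> sink_group p b \<Longrightarrow> (x, v) \<in> r"
    using assms by (simp_all add: type_C_def)
  ultimately show "v \<in> source_group p a \<longleftrightarrow> (v, x) \<in> r" "v \<in> sink_group p b \<longleftrightarrow> (x, v) \<in> r"
    using asym by blast+
qed

lemma type_C_index:
  assumes C: "type_C G D p x a b"
  shows "(v, x) \<in> r \<longleftrightarrow> (\<exists>i<a. v = p ! i)"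
    "(x, v) \<in> r \<longleftrightarrow> (\<exists>i. b - 1 \<le> i \<and> i < length p \<and> v = p ! i)"
proof -
  have "1 \<le> b" "a \<le> length p"
    using C by (auto simp: type_C_def)
  then show "(v, x) \<in> r \<longleftrightarrow> (\<exists>i<a. v = p ! i)"
    using type_C_groups(1)[OF C, of v] source_group_eq_take[of a p] nth_image[of a p]
    by (metis (mono_tags, lifting) atLeast0LessThan image_iff lessThan_iff)
  show "(x, v) \<in> r \<longleftrightarrow> (\<exists>i. b - 1 \<le> i \<and> i < length p \<and> v = p ! i)"
    using type_C_groups(2)[OF C, of v] sink_group_eq_drop[OF \<open>1 \<le> b\<close>, of p] set_drop_eq_nth[of "b - 1" p]
    by auto
qed

lemma type_C_ends:
  assumes C: "type_C G D p x a b"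
  shows "(path_vertex p a, x) \<in> r" "(x, path_vertex p b) \<in> r"
  using C type_C_groups[OF C] by (auto simp: type_C_def source_group_def sink_group_def)

text \<open>The first three facts are local conditions for \<open>acyclic_four_path_closedI\<close>;
  the last two single out the extreme neighbours to which separation is reduced.\<close>

lemma type_C_order:
  assumes C: "type_C G D p x a b"
  shows "\<lbrakk>(u, x) \<in> r; (x, w) \<in> r\<rbrakk> \<Longrightarrow> (u, w) \<in> r"
    and "\<lbrakk>u \<in> K; (u, v) \<in> r; (v, x) \<in> r\<rbrakk> \<Longrightarrow> (u, x) \<in> r"
    and "\<lbrakk>w \<in> K; (x, v) \<in> r; (v, w) \<in> r\<rbrakk> \<Longrightarrow> (x, w) \<in> r"
    and "(u, x) \<in> r \<Longrightarrow> u = path_vertex p a \<or> (u, path_vertex p a) \<in> r"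
    and "(x, w) \<in> r \<Longrightarrow> w = path_vertex p b \<or> (path_vertex p b, w) \<in> r"
proof -
  note index = type_C_index[OF C]
  have ab: "1 \<le> a" "a < b" "b \<le> length p"
    using C by (auto simp: type_C_def)
  show "(u, w) \<in> r" if "(u, x) \<in> r" "(x, w) \<in> r"
    using that ab sorted_nth unfolding index by fastforce
  show "(u, x) \<in> r" if "u \<in> K" "(u, v) \<in> r" "(v, x) \<in> r"
    using that ab K_index[of u] nth_arc_imp_less unfolding index
    by (metis order.strict_trans order.strict_trans2)
  show "(x, w) \<in> r" if "w \<in> K" "(x, v) \<in> r" "(v, w) \<in> r"
    using that ab K_index[of w] nth_arc_imp_less unfolding index
    by (metis less_or_eq_imp_le order.trans)
  show "u = path_vertex p a \<or> (u, path_vertex p a) \<in> r" if u: "(u, x) \<in> r"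
  proof -
    obtain i where "i < a" "u = p ! i"
      using u index by blast
    then show ?thesis
      using ab sorted_nth[of i "a - 1"] by (cases "i = a - 1") (auto simp: path_vertex_def)
  qed
  show "w = path_vertex p b \<or> (path_vertex p b, w) \<in> r" if w: "(x, w) \<in> r"
  proof -
    obtain i where "b - 1 \<le> i" "i < length p" "w = p ! i"
      using w index by blast
    then show ?thesis
      using sorted_nth[of "b - 1" i] by (cases "i = b - 1") (auto simp: path_vertex_def)
  qed
qed

lemma type_A_out:
  assumes "type_A G D p x"
  shows "(v, x) \<notin> r" "v \<in> nbhd G x \<longleftrightarrow> (x, v) \<in> r"
proof -
  have "v \<in> nbhd G x \<longrightarrow> (x, v) \<in> r"
    using assms by (simp add: type_A_def)
  then show "(v, x) \<notin> r" "v \<in> nbhd G x \<longleftrightarrow> (x, v) \<in> r"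
    using asym[of v x] asym[of x v] mem_nbhd[of v x] by argo+
qed

lemma type_B_in:
  assumes "type_B G D p x"
  shows "(x, v) \<notin> r" "v \<in> nbhd G x \<longleftrightarrow> (v, x) \<in> r"
proof -
  have "v \<in> nbhd G x \<longrightarrow> (v, x) \<in> r"
    using assms by (simp add: type_B_def)
  then show "(x, v) \<notin> r" "v \<in> nbhd G x \<longleftrightarrow> (v, x) \<in> r"
    using asym[of v x] asym[of x v] mem_nbhd[of v x] by argo+
qed

text \<open>If the arcs at \<open>x\<close> all point the same way, a vertex between two neighbours
  completes a path on four vertices starting or ending at \<open>x\<close>, so the neighbourhood is
  convex. Otherwise \<open>x\<close> is an inner vertex of such paths, and its groups are closed
  downwards and upwards.\<close>

lemma four_path_closed_imp_types:
  assumes ac: "acyclic r" and closed: "four_path_closed r" and x: "x \<in> E"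
  shows "type_A G D p x \<or> type_B G D p x \<or> (\<exists>a b. type_C G D p x a b)"
proof -
  note C = four_path_closedD[OF closed]
  have sub: "nbhd G x \<subseteq> set p"
    using nbhd_sub_K[OF x] set_p by simp
  consider "\<And>v. (v, x) \<notin> r" | "\<And>v. (x, v) \<notin> r" | u w where "(u, x) \<in> r" "(x, w) \<in> r"
    by blast
  then show ?thesis
  proof cases
    case 1
    have "v \<in> nbhd G x" if "u \<in> nbhd G x" "w \<in> nbhd G x" "(u, v) \<in> r" "(v, w) \<in> r" for u v w
      using 1 that C(1)[of x u v w] unfolding mem_nbhd by blast
    then have "\<exists>q. sublist q p \<and> nbhd G x = set q"
      by (intro sublist_of_convex[OF sorted_p sub])
    then show ?thesis using 1 by (simp add: type_A_def mem_nbhd)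
  next
    case 2
    have "v \<in> nbhd G x" if "u \<in> nbhd G x" "w \<in> nbhd G x" "(u, v) \<in> r" "(v, w) \<in> r" for u v w
      using 2 that C(2)[of u v w x] unfolding mem_nbhd by blast
    then have "\<exists>q. sublist q p \<and> nbhd G x = set q"
      by (intro sublist_of_convex[OF sorted_p sub])
    then show ?thesis using 2 by (simp add: type_B_def mem_nbhd)
  next
    case (3 u w)
    \<comment> \<open>Supplies the closing arcs: clique vertices linked by a walk through
      \<open>x\<close> are adjacent in that direction.\<close>
    have arc: "(s, t) \<in> r" if "(s, x) \<in> r\<^sup>+" "(x, t) \<in> r\<^sup>+" "s \<in> K" "t \<in> K" for s t
      using trancl_clique[OF ac] that by (meson trancl_trans)
    have "\<exists>a b. type_C G D p x a b"
    proof (rule type_CI[OF x 3])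
      fix s v
      assume s: "s \<in> K" "(s, v) \<in> r" "(v, x) \<in> r"
      then have "(s, w) \<in> r"
        using arc[of s w] 3(2) nbr_E[OF x] by (meson trancl.intros)
      then show "(s, x) \<in> r" using C(1)[OF s(2,3) 3(2)] by blast
    next
      fix v t
      assume t: "t \<in> K" "(x, v) \<in> r" "(v, t) \<in> r"
      then have "(u, t) \<in> r"
        using arc[of u t] 3(1) nbr_E[OF x] by (meson trancl.intros)
      then show "(x, t) \<in> r" using C(2)[OF 3(1) t(2,3)] by blast
    qed
    then show ?thesis by blast
  qed
qed

text \<open>With \<open>s\<close> and \<open>t\<close> for \<open>path_vertex p a\<close> and
  \<open>path_vertex p b\<close>, a forbidden \<open>y\<close> would close the path
  \<open>y\<close>, \<open>s\<close>, \<open>x\<close>, \<open>t\<close> or the path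
  \<open>s\<close>, \<open>x\<close>, \<open>t\<close>, \<open>y\<close>, forcing an arc between the
  independent vertices \<open>x\<close> and \<open>y\<close>.\<close>

lemma four_path_closed_imp_separated:
  assumes closed: "four_path_closed r" and x: "x \<in> E" and C: "type_C G D p x a b"
  shows "\<not> (\<exists>y\<in>E. (type_A G D p y \<or> type_B G D p y) \<and>
              path_vertex p a \<in> nbhd G y \<and> path_vertex p b \<in> nbhd G y)"
    and "\<not> (\<exists>y\<in>E. \<exists>a' b'. type_C G D p y a' b' \<and>
              ({path_vertex p a, path_vertex p b} \<subseteq> source_group p a' \<or>
               {path_vertex p a, path_vertex p b} \<subseteq> sink_group p b'))"
proof -
  let ?s = "path_vertex p a" and ?t = "path_vertex p b"
  have no: "\<not> ((y, ?s) \<in> r \<and> (y, ?t) \<in> r)" "\<not> ((?s, y) \<in> r \<and> (?t, y) \<in> r)" if "y \<in> E" for y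
    using four_path_closedD[OF closed] type_C_ends[OF C] independent x that by blast+
  show "\<not> (\<exists>y\<in>E. (type_A G D p y \<or> type_B G D p y) \<and> ?s \<in> nbhd G y \<and> ?t \<in> nbhd G y)"
    using no by (metis type_A_out(2) type_B_in(2))
  show "\<not> (\<exists>y\<in>E. \<exists>a' b'. type_C G D p y a' b' \<and>
      ({?s, ?t} \<subseteq> source_group p a' \<or> {?s, ?t} \<subseteq> sink_group p b'))"
    using no by (metis insert_subset type_C_groups)
qed

lemma types_imp_four_path_closed:
  assumes trans: "trans (r \<inter> K \<times> K)"
    and types: "\<forall>x\<in>E. type_A G D p x \<or> type_B G D p x \<or> (\<exists>a b. type_C G D p x a b)"
    and separated: "\<forall>x\<in>E. \<forall>a b. type_C G D p x a b \<longrightarrow>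
        \<not> (\<exists>y\<in>E. (type_A G D p y \<or> type_B G D p y) \<and>
              path_vertex p a \<in> nbhd G y \<and> path_vertex p b \<in> nbhd G y) \<and>
        \<not> (\<exists>y\<in>E. \<exists>a' b'. type_C G D p y a' b' \<and>
              ({path_vertex p a, path_vertex p b} \<subseteq> source_group p a' \<or>
               {path_vertex p a, path_vertex p b} \<subseteq> sink_group p b'))"
  shows "acyclic r \<and> four_path_closed r"
proof -
  have type_C: "\<exists>a b. type_C G D p x a b" if "x \<in> E" "(u, x) \<in> r" "(x, w) \<in> r" for x u w
    using types that type_A_out(1)[of x] type_B_in(1)[of x] by blast
  have out_convex: "(x, v) \<in> r"
    if x: "x \<in> E" and v: "v \<in> K" and arcs: "(x, u) \<in> r" "(x, w) \<in> r" "(u, v) \<in> r" "(v, w) \<in> r" for x u v w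
  proof -
    consider "type_A G D p x" | a b where "type_C G D p x a b"
      using types x arcs(1) type_B_in(1)[of x] by blast
    then show ?thesis
    proof cases
      case 1
      then obtain q where q: "sublist q p" "nbhd G x = set q"
        by (auto simp: type_A_def)
      have "v \<in> nbhd G x"
        using sublist_convex[OF q(1), of u w v] q(2) v arcs by (metis mem_nbhd)
      then show ?thesis using type_A_out(2)[OF 1] by blast
    next
      case 2
      then show ?thesis using type_C_order(3)[OF 2 v] arcs by blast
    qed
  qed
  have in_convex: "(v, x) \<in> r"
    if x: "x \<in> E" and v: "v \<in> K" and arcs: "(u, x) \<in> r" "(w, x) \<in> r" "(u, v) \<in> r" "(v, w) \<in> r" for x u v w
  proof -
    consider "type_B G D p x" | a b where "type_C G D p x a b"
      using types x arcs(1) type_A_out(1)[of x] by blast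
    then show ?thesis
    proof cases
      case 1
      then obtain q where q: "sublist q p" "nbhd G x = set q"
        by (auto simp: type_B_def)
      have "v \<in> nbhd G x"
        using sublist_convex[OF q(1), of u w v] q(2) v arcs by (metis mem_nbhd)
      then show ?thesis using type_B_in(2)[OF 1] by blast
    next
      case 2
      then show ?thesis using type_C_order(2)[OF 2 v] arcs by blast
    qed
  qed
  have sep: "\<not> ((y, u) \<in> r \<and> (y, w) \<in> r) \<and> \<not> ((u, y) \<in> r \<and> (w, y) \<in> r)"
    if x: "x \<in> E" and y: "y \<in> E" and uw: "(u, x) \<in> r" "(x, w) \<in> r" for x y u w
  proof -
    obtain a b where C: "type_C G D p x a b"
      using type_C x uw by blast
    let ?s = "path_vertex p a" and ?t = "path_vertex p b"
    note s = type_C_order(4)[OF C uw(1)] and t = type_C_order(5)[OF C uw(2)]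
    have st: "(?s, w) \<in> r" "(u, ?t) \<in> r" "?s \<in> K" "?t \<in> K"
      using type_C_order(1)[OF C] type_C_ends[OF C] uw nbr_E[OF x] by blast+
    \<comment> \<open>Along the path \<open>u\<close>, \<open>?s\<close>, \<open>?t\<close>,
      \<open>w\<close> occur in this order, possibly with \<open>u = ?s\<close> or
      \<open>?t = w\<close>. Convexity thus carries adjacency of \<open>y\<close> from
      \<open>u\<close> and \<open>w\<close> to the extreme pair, the only one that the hypothesis
      mentions.\<close>
    have "(y, ?s) \<in> r \<and> (y, ?t) \<in> r" if "(y, u) \<in> r" "(y, w) \<in> r"
      using out_convex[OF y _ that] s t st that by blast
    moreover have "(?s, y) \<in> r \<and> (?t, y) \<in> r" if "(u, y) \<in> r" "(w, y) \<in> r"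
      using in_convex[OF y _ that] s t st that by blast
    moreover have "\<not> ((y, ?s) \<in> r \<and> (y, ?t) \<in> r) \<and> \<not> ((?s, y) \<in> r \<and> (?t, y) \<in> r)"
    proof (cases "\<exists>a' b'. type_C G D p y a' b'")
      case True
      then obtain a' b' where C': "type_C G D p y a' b'"
        by blast
      then have "\<not> ({?s, ?t} \<subseteq> source_group p a' \<or> {?s, ?t} \<subseteq> sink_group p b')"
        using separated[rule_format, OF x C] y by blast
      then show ?thesis
        by (simp add: type_C_groups[OF C'])
    next
      case False
      then have "type_A G D p y \<or> type_B G D p y"
        using types y by blast
      then have "?s \<notin> nbhd G y \<or> ?t \<notin> nbhd G y"
        using separated[rule_format, OF x C] y by blast
      then show ?thesis
        by (auto simp: mem_nbhd)
    qed
    ultimately show ?thesis by blast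
  qed
  show ?thesis
  proof (rule acyclic_four_path_closedI)
    show "(u, w) \<in> r" if "u \<in> K" "v \<in> K" "w \<in> K" "(u, v) \<in> r" "(v, w) \<in> r" for u v w
      using transD[OF trans, of u v w] that by blast
    show "(u, w) \<in> r" if "x \<in> E" "(u, x) \<in> r" "(x, w) \<in> r" for x u w
      using type_C[OF that] type_C_order(1) that by metis
    show "(u, x) \<in> r" if "x \<in> E" "u \<in> K" "(u, v) \<in> r" "(v, x) \<in> r" "(x, w) \<in> r" for x u v w
      using type_C[OF that(1,4,5)] type_C_order(2) that by metis
    show "(x, w) \<in> r" if "x \<in> E" "w \<in> K" "(u, x) \<in> r" "(x, v) \<in> r" "(v, w) \<in> r" for x u v w
      using type_C[OF that(1,3,4)] type_C_order(3) that by metis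
  qed (fact out_convex in_convex sep)+
qed

end

end

theorem theorem18:
  fixes G D :: "'a pair_pre_digraph" and E K :: "'a set"
  assumes "split_graph G E K"
    and "orientation_of D G"
  shows "semi_transitive (with_proj D) \<longleftrightarrow>
    transitive_digraph (with_proj D \<restriction> K) \<and>
    (\<exists>p. hamiltonian_dipath (with_proj D \<restriction> K) p \<and>
      (\<forall>x\<in>E. type_A G D p x \<or> type_B G D p x \<or> (\<exists>a b. type_C G D p x a b)) \<and>
      (\<forall>x\<in>E. \<forall>a b. type_C G D p x a b \<longrightarrow>
        \<not> (\<exists>y\<in>E. (type_A G D p y \<or> type_B G D p y) \<and>
              path_vertex p a \<in> nbhd G y \<and> path_vertex p b \<in> nbhd G y) \<and>
        \<not> (\<exists>y\<in>E. \<exists>a' b'. type_C G D p y a' b' \<and>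
              ({path_vertex p a, path_vertex p b} \<subseteq> source_group p a' \<or>
               {path_vertex p a, path_vertex p b} \<subseteq> sink_group p b'))))"
    (is "_ \<longleftrightarrow> _ \<and> (\<exists>p. _ \<and> ?types p \<and> ?separated p)")
proof -
  interpret oriented_split_graph G D E K
    using assms by unfold_locales
  show ?thesis
  proof
    assume "semi_transitive (with_proj D)"
    then have ac: "acyclic r" and closed: "four_path_closed r"
      by (simp_all add: semi_transitive_iff)
    have tr: "trans (r \<inter> K \<times> K)"
    proof (rule transI)
      fix u v w
      assume *: "(u, v) \<in> r \<inter> K \<times> K" "(v, w) \<in> r \<inter> K \<times> K"
      then have "(u, w) \<in> r\<^sup>+"
        by (meson IntD1 trancl.intros)
      then show "(u, w) \<in> r \<inter> K \<times> K"
        using trancl_clique[OF ac] * by blast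
    qed
    obtain p where p: "distinct p" "set p = K" "sorted_wrt (\<lambda>u v. (u, v) \<in> r) p"
      using finite_total_acyclic_sorted_list[OF finite_K ac clique] by blast
    have "hamiltonian_dipath (with_proj D \<restriction> K) p"
      using p by (simp add: hamiltonian_dipath_iff[OF tr])
    moreover have "?types p"
      using four_path_closed_imp_types[OF p(2,3) ac closed] by blast
    moreover have "?separated p"
      by (intro ballI allI impI conjI; rule four_path_closed_imp_separated[OF p(2,3) closed]; assumption)
    ultimately show "transitive_digraph (with_proj D \<restriction> K) \<and>
        (\<exists>p. hamiltonian_dipath (with_proj D \<restriction> K) p \<and> ?types p \<and> ?separated p)"
      using tr by (auto simp: transitive_digraph_def)
  next
    assume "transitive_digraph (with_proj D \<restriction> K) \<and>
        (\<exists>p. hamiltonian_dipath (with_proj D \<restriction> K) p \<and> ?types p \<and> ?separated p)"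
    then obtain p where tr: "trans (r \<inter> K \<times> K)"
      and ham: "hamiltonian_dipath (with_proj D \<restriction> K) p"
      and types: "?types p" and separated: "?separated p"
      by (auto simp: transitive_digraph_def)
    \<comment> \<open>Transitivity of the clique turns consecutive arcs into arcs between all pairs
      of positions.\<close>
    have "set p = K" "sorted_wrt (\<lambda>u v. (u, v) \<in> r) p"
      using ham by (simp_all add: hamiltonian_dipath_iff[OF tr])
    then show "semi_transitive (with_proj D)"
      using types_imp_four_path_closed[OF _ _ tr types separated] by (simp add: semi_transitive_iff)
  qed
qed

end
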